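(* Let $n\ge1$ be an integer, $\lambda\in(0,1)$ and $\delta>0$. There exists an infinite word $w$ over a two-letter alphabet $\Sigma$ such that $$n < \mathrm{ACE}(w)\le n+\lambda \quad\text{and}\quad \mathrm{ACE}_{\mathcal{I}}(w)\ge n+1-\delta,$$ where $\mathrm{ACE}_{\mathcal{I}}$ is taken with respect to injective morphisms $\Sigma^*\to\Gamma^*$ for any finite alphabet $\Gamma$ with at least two letters.
   Context: $\mathrm{Fact}_m(w)$ is the set of length-$m$ factors of $w$. For a nonempty word $v$ and integer $p\ge0$, $v^{p/|v|}$ is the prefix of length $p$ of $vvv\cdots$. For a nonempty finite word $x$, $\mathrm{E}(x) = \sup\{ r \in \mathbb{Q} : x = v^r \text{ for some nonempty } v\}$. $\mathrm{ACE}(w) = \limsup_{m\to\infty}\sup\{\mathrm{E}(x) : x\in\mathrm{Fact}_m(w)\}$. $\mathcal{I}$ is the set of injective morphisms $\Sigma^*\to\Gamma^*$ and $\mathrm{ACE}_{\mathcal{I}}(w) = \sup\{\mathrm{ACE}(h(w)) : h\in\mathcal{I}\}$. *)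

theory Defs
  imports Complex_Main "HOL-Library.Extended_Real" "HOL-Library.Liminf_Limsup"
begin

definition Fact :: "nat \<Rightarrow> (nat \<Rightarrow> 'a) \<Rightarrow> 'a list set" where
  "Fact m w = {map (\<lambda>j. w (i + j)) [0..<m] | i. True}"

text \<open>x = v^r (v nonempty, r rational): r = |x|/|v| and x is the prefix of
  length |x| of vvv..., i.e. x_i = v_(i mod |v|).\<close>
definition is_power :: "'a list \<Rightarrow> 'a list \<Rightarrow> real \<Rightarrow> bool" where
  "is_power x v r \<longleftrightarrow> v \<noteq> [] \<and> r * real (length v) = real (length x)
     \<and> (\<forall>i < length x. x ! i = v ! (i mod length v))"

definition Exp :: "'a list \<Rightarrow> ereal" where
  "Exp x = Sup {ereal r | r v. r \<in> \<rat> \<and> is_power x v r}"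

definition ACE :: "(nat \<Rightarrow> 'a) \<Rightarrow> ereal" where
  "ACE w = limsup (\<lambda>m. SUP x \<in> Fact m w. Exp x)"

definition morph :: "('a \<Rightarrow> 'b list) \<Rightarrow> 'a list \<Rightarrow> 'b list" where
  "morph f u = concat (map f u)"

text \<open>Image of an infinite word under a non-erasing morphism (injective morphisms
  are non-erasing): the k-th letter of h(w) is the k-th letter of h(w_0 ... w_k).\<close>
definition morph_inf :: "('a \<Rightarrow> 'b list) \<Rightarrow> (nat \<Rightarrow> 'a) \<Rightarrow> nat \<Rightarrow> 'b" where
  "morph_inf f w k = morph f (map w [0..<Suc k]) ! k"

definition ACE_I :: "'b set \<Rightarrow> (nat \<Rightarrow> 'a) \<Rightarrow> ereal" where
  "ACE_I \<Gamma> w = (SUP f \<in> {f. inj (morph f) \<and> (\<forall>a. set (f a) \<subseteq> \<Gamma>)}. ACE (morph_inf f w))"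

end

theory Submission
  imports Defs
begin

text \<open>
  A long repetition \<open>v\<^sup>n v'\<close> with \<open>v'\<close> a short prefix of \<open>v = v' v''\<close> becomes almost an
  \<open>(n + 1)\<close>-th power under a morphism that blows up the letter \<open>True\<close>, provided \<open>v'\<close> consists
  mostly of \<open>True\<close> and \<open>v''\<close> mostly of \<open>False\<close>. The word is therefore \<open>True\<close> almost everywhere,
  except that after each position \<open>D k = 2 ^ (G * k)\<close> there are \<open>n\<close> long stretches, periodically
  spaced at distance \<open>D k\<close>, that are almost everywhere \<open>False\<close>. Other long repetitions are
  prevented by sparse deviations \<open>c\<close> at multiples of \<open>2 ^ b\<close>: a position \<open>x\<close> of 2-adic valuation
  \<open>f\<close> carries bit \<open>f + t\<close> of \<open>x\<close>. If a distance \<open>d\<close> has valuation \<open>e\<close>, adding \<open>d\<close> flips this bit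
  at every position of valuation \<open>e - t\<close>, so that factors at distance \<open>d\<close> agree on a length of at
  most about \<open>2 ^ (e - t + 1) \<le> 2 d / 2 ^ t\<close>. The intended repetitions survive because in the zone
  around \<open>D k\<close> the deviations that would break the period \<open>D k\<close> are switched off; there the
  pattern of the \<open>False\<close> stretches limits the repetitions instead.
\<close>

section \<open>Asymptotic critical exponent and periodic windows\<close>

lemma is_power_factor:
  fixes g :: "nat \<Rightarrow> 'a"
  assumes d: "0 < d" "d \<le> m" and per: "\<And>j. j + d < m \<Longrightarrow> g (s + j + d) = g (s + j)"
  shows "is_power (map (\<lambda>j. g (s + j)) [0..<m]) (map (\<lambda>j. g (s + j)) [0..<d]) (real m / real d)"
proof -
  have "g (s + i) = g (s + i mod d)" if "i < m" for i
    using that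
  proof (induction i rule: less_induct)
    case (less i)
    show ?case
    proof (cases "i < d")
      case False
      then have "g (s + (i - d)) = g (s + (i - d) mod d)"
        using less.IH[of "i - d"] less.prems d by (simp del: add_diff_assoc)
      moreover have "g (s + i) = g (s + (i - d))"
        using per[of "i - d"] False less.prems by simp
      ultimately show ?thesis using False by (simp add: le_mod_geq)
    qed simp
  qed
  then show ?thesis using d by (auto simp: is_power_def)
qed

text \<open>A window of length \<open>m\<close> with period \<open>d\<close> is a factor with
  \<open>Exp\<close> at least \<open>m / d\<close>; the lengths \<open>m\<close> are unbounded, so
  these factors count in the limsup.\<close>

lemma ACE_ge:
  fixes g :: "nat \<Rightarrow> 'a" and \<rho> :: real
  assumes "\<And>N. \<exists>s d m. N \<le> m \<and> 0 < d \<and> d \<le> m \<and> \<rho> * real d \<le> real m \<and>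
    (\<forall>j. j + d < m \<longrightarrow> g (s + j + d) = g (s + j))"
  shows "ereal \<rho> \<le> ACE g"
proof -
  have "\<exists>m\<ge>N. ereal \<rho> \<le> (SUP x \<in> Fact m g. Exp x)" for N
  proof -
    obtain s d m where *: "N \<le> m" "0 < d" "d \<le> m" "\<rho> * real d \<le> real m"
      "\<forall>j. j + d < m \<longrightarrow> g (s + j + d) = g (s + j)"
      using assms by blast
    let ?x = "map (\<lambda>j. g (s + j)) [0..<m]"
    have "is_power ?x (map (\<lambda>j. g (s + j)) [0..<d]) (real m / real d)"
      using * by (intro is_power_factor) auto
    moreover have "real m / real d \<in> \<rat>" by simp
    ultimately have "ereal (real m / real d) \<le> Exp ?x"
      unfolding Exp_def by (intro Sup_upper) blast
    also have "\<dots> \<le> (SUP x \<in> Fact m g. Exp x)"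
      by (intro SUP_upper) (auto simp: Fact_def)
    finally have "ereal (real m / real d) \<le> (SUP x \<in> Fact m g. Exp x)" .
    moreover have "\<rho> \<le> real m / real d" using * by (simp add: field_simps)
    ultimately show ?thesis using \<open>N \<le> m\<close> by (meson ereal_less_eq(3) order_trans)
  qed
  then show ?thesis
    unfolding ACE_def limsup_INF_SUP by (intro INF_greatest) (meson SUP_upper2 atLeast_iff)
qed

text \<open>A power of length \<open>m\<close> with period \<open>d < m\<close> is an agreement of
  length \<open>m - d\<close> at distance \<open>d\<close>, so its exponent is at most
  \<open>\<rho> + C / d\<close>. Long factors force \<open>d\<close> to be large, which makes
  \<open>C / d\<close> at most \<open>\<epsilon>\<close>.\<close>

lemma ACE_le:
  fixes g :: "nat \<Rightarrow> 'a" and \<rho> \<epsilon> C :: real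
  assumes "\<rho> \<ge> 1" "\<epsilon> > 0" "C \<ge> 0"
    and run: "\<And>i d l. 0 < d \<Longrightarrow> (\<And>x. i \<le> x \<Longrightarrow> x < i + l \<Longrightarrow> g x = g (x + d)) \<Longrightarrow>
      real l \<le> (\<rho> - 1) * real d + C"
  shows "ACE g \<le> ereal (\<rho> + \<epsilon>)"
proof -
  \<comment> \<open>From \<open>m \<ge> N\<close> and \<open>m \<le> \<rho> * d + C\<close> follows
    \<open>\<rho> * d \<ge> C * \<rho> / \<epsilon>\<close>, that is
    \<open>C \<le> \<epsilon> * d\<close>.\<close>
  define N where "N = nat \<lceil>C * \<rho> / \<epsilon> + C\<rceil> + 1"
  have bound: "r \<le> \<rho> + \<epsilon>" if "m \<ge> N" "is_power (map (\<lambda>j. g (i + j)) [0..<m]) v r" for m i v r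
  proof -
    define d where "d = length v"
    have d: "d > 0" and rd: "r * real d = real m"
      and per: "\<And>j. j < m \<Longrightarrow> g (i + j) = v ! (j mod d)"
      using that(2) by (auto simp: is_power_def d_def)
    show ?thesis
    proof (cases "m \<le> d")
      case True
      then have "r * real d \<le> 1 * real d" using rd by simp
      then have "r \<le> 1" using d by simp
      then show ?thesis using assms by linarith
    next
      case False
      have "real (m - d) \<le> (\<rho> - 1) * real d + C"
      proof (rule run[of d i "m - d"])
        fix x assume x: "i \<le> x" "x < i + (m - d)"
        then show "g x = g (x + d)"
          using per[of "x - i"] per[of "x - i + d"] mod_add_self2[of "x - i" d]
          by (simp del: mod_add_self2 add: add.commute add.left_commute)
      qed (use d in simp)
      then have le: "real m \<le> \<rho> * real d + C"
        using False by (simp add: algebra_simps of_nat_diff)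
      have "C * \<rho> / \<epsilon> + C \<le> real N" unfolding N_def by linarith
      then have "C * \<rho> / \<epsilon> \<le> \<rho> * real d"
        using le that(1) by (smt (verit) of_nat_le_iff)
      then have "\<rho> * (C / \<epsilon>) \<le> \<rho> * real d" by (simp add: mult.commute)
      then have "C / \<epsilon> \<le> real d" using assms(1) by (simp only: mult_le_cancel_left_pos)
      then have "C \<le> \<epsilon> * real d" using assms(2) by (simp add: field_simps)
      then have "r * real d \<le> (\<rho> + \<epsilon>) * real d" using le rd by (simp add: algebra_simps)
      then show ?thesis using d by simp
    qed
  qed
  have "(SUP x \<in> Fact m g. Exp x) \<le> ereal (\<rho> + \<epsilon>)" if "m \<ge> N" for m
    using bound[OF that] by (auto simp: Fact_def Exp_def intro!: SUP_least Sup_least)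
  then show ?thesis
    unfolding ACE_def by (intro Limsup_bounded) (auto simp: eventually_sequentially)
qed

section \<open>Images of infinite words\<close>

lemma morph_append: "morph f (u @ v) = morph f u @ morph f v"
  by (simp add: morph_def)

lemma length_morph_upt:
  "length (morph f (map w [0..<i])) = (\<Sum>x<i. length (f (w x)))"
  by (induction i) (simp_all add: morph_append, simp_all add: morph_def)

lemma morph_inf_nth:
  assumes ne: "\<And>x. f x \<noteq> []" and j: "j < length (f (w i))"
  shows "morph_inf f w ((\<Sum>x<i. length (f (w x))) + j) = f (w i) ! j"
proof -
  define H where "H = (\<lambda>i. \<Sum>x<i. length (f (w x)))"
  \<comment> \<open>Since no image is empty, the prefix that \<open>morph_inf\<close> uses at
    position \<open>H i + j\<close> is long enough to contain the letter \<open>w i\<close>.\<close>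
  have "i \<le> H i" for i
  proof (induction i)
    case (Suc i)
    moreover have "length (f (w i)) > 0" using ne by simp
    ultimately show ?case unfolding H_def sum.lessThan_Suc by linarith
  qed (simp add: H_def)
  then have "i \<le> H i" .
  then have "[0..<Suc (H i + j)] = [0..<Suc i] @ [Suc i..<Suc (H i + j)]"
    using upt_add_eq_append[of 0 "Suc i" "H i + j - i"] by simp
  then have "morph f (map w [0..<Suc (H i + j)]) =
      morph f (map w [0..<i]) @ f (w i) @ morph f (map w [Suc i..<Suc (H i + j)])"
    by (simp add: morph_append) (simp add: morph_def)
  moreover have "length (morph f (map w [0..<i])) = H i"
    by (simp add: H_def length_morph_upt)
  ultimately have "morph_inf f w (H i + j) = f (w i) ! j"
    using j unfolding morph_inf_def by (simp del: upt_Suc add: nth_append)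
  then show ?thesis by (simp add: H_def)
qed

lemma morph_inf_periodic:
  assumes ne: "\<And>x. f x \<noteq> []"
    and per: "\<And>x. s \<le> x \<Longrightarrow> x < s + l \<Longrightarrow> w x = w (x + d)"
    and j: "j < (\<Sum>x = s..<s + l. length (f (w x)))"
  shows "morph_inf f w ((\<Sum>x<s. length (f (w x))) + j + (\<Sum>x = s..<s + d. length (f (w x)))) =
    morph_inf f w ((\<Sum>x<s. length (f (w x))) + j)"
proof -
  define H where "H = (\<lambda>i. \<Sum>x<i. length (f (w x)))"
  have Hsum: "(\<Sum>x = u..<v. length (f (w x))) = H v - H u" "H u \<le> H v" if "u \<le> v" for u v
  proof -
    have "H v = H u + (\<Sum>x = u..<v. length (f (w x)))"
      using that by (simp add: H_def lessThan_atLeast0 sum.atLeastLessThan_concat)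
    then show "(\<Sum>x = u..<v. length (f (w x))) = H v - H u" "H u \<le> H v" by auto
  qed
  \<comment> \<open>The letter whose image covers position \<open>H s + j\<close> has index
    \<open>i = i' - 1\<close>, and \<open>r\<close> is the offset in that image. The same offset in
    the image of letter \<open>i + d\<close> lies exactly one period image further on.\<close>
  define P where "P = (\<lambda>i. H s + j < H i)"
  have "P (s + l)" using j Hsum[of s "s + l"] by (simp add: P_def)
  define i' where "i' = (LEAST i. P i)"
  have P': "P i'" unfolding i'_def by (rule LeastI) (rule \<open>P (s + l)\<close>)
  have le': "i' \<le> s + l" unfolding i'_def by (rule Least_le) (rule \<open>P (s + l)\<close>)
  have "s < i'" using P' Hsum(2)[of i' s] by (fastforce simp: P_def)
  then obtain i where i: "i' = Suc i" "s \<le> i" by (cases i') auto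
  have "\<not> P i" using i(1) not_less_Least[of i P] by (simp add: i'_def)
  moreover define r where "r = H s + j - H i"
  ultimately have r: "H s + j = H i + r" "r < length (f (w i))"
    using P' i by (auto simp: P_def H_def)
  have il: "i < s + l" using le' i by simp
  have "(\<Sum>x = s + d..<i + d. length (f (w x))) = (\<Sum>x = s..<i. length (f (w (x + d))))"
    by (rule sum.shift_bounds_nat_ivl)
  also have "\<dots> = (\<Sum>x = s..<i. length (f (w x)))"
    using il per by (intro sum.cong) auto
  finally have "H (i + d) = H i + (H (s + d) - H s)"
    using Hsum[of "s + d" "i + d"] Hsum[of s i] Hsum[of s "s + d"] i by simp
  then have "morph_inf f w (H s + j + (H (s + d) - H s)) = morph_inf f w (H (i + d) + r)"
    using r by (simp add: ac_simps)
  also have "\<dots> = f (w i) ! r"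
    using morph_inf_nth[of f r w "i + d"] ne r per[of i] i il by (simp add: H_def)
  also have "\<dots> = morph_inf f w (H s + j)"
    using morph_inf_nth[of f r w i] ne r by (simp add: H_def)
  finally show ?thesis using Hsum[of s "s + d"] by (simp add: H_def)
qed

lemma ACE_morph_inf_ge:
  fixes f :: "'a \<Rightarrow> 'b list"
  assumes ne: "\<And>x. f x \<noteq> []"
    and ex: "\<And>N. \<exists>s d l. N \<le> l \<and> 0 < d \<and>
      (\<forall>x. s \<le> x \<longrightarrow> x < s + l \<longrightarrow> w x = w (x + d)) \<and>
      \<rho> * real (\<Sum>x = s..<s + d. length (f (w x))) \<le> real (\<Sum>x = s..<s + d + l. length (f (w x)))"
  shows "ereal \<rho> \<le> ACE (morph_inf f w)"
proof (rule ACE_ge)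
  fix N
  obtain s d l where *: "N \<le> l" "0 < d" "\<And>x. s \<le> x \<Longrightarrow> x < s + l \<Longrightarrow> w x = w (x + d)"
    "\<rho> * real (\<Sum>x = s..<s + d. length (f (w x))) \<le> real (\<Sum>x = s..<s + d + l. length (f (w x)))"
    using ex by meson
  define H where "H = (\<lambda>i. \<Sum>x<i. length (f (w x)))"
  define S where "S = (\<lambda>u v. \<Sum>x = u..<v. length (f (w x)))"
  have pos: "length (f y) \<ge> 1" for y using ne[of y] by (cases "f y") auto
  have big: "v - u \<le> S u v" for u v
    using sum_mono[of "{u..<v}" "\<lambda>_. 1::nat" "\<lambda>x. length (f (w x))"] pos by (simp add: S_def)
  have split: "S s (s + d + l) = S s (s + d) + S (s + d) (s + d + l)"
    unfolding S_def by (simp add: sum.atLeastLessThan_concat)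
  have "S (s + d) (s + d + l) = (\<Sum>x = s..<s + l. length (f (w (x + d))))"
    unfolding S_def using sum.shift_bounds_nat_ivl[of _ s d "s + l"] by (simp add: add.commute add.left_commute)
  also have "\<dots> = S s (s + l)" unfolding S_def using *(3) by (intro sum.cong) auto
  finally have shift: "S (s + d) (s + d + l) = S s (s + l)" .
  show "\<exists>s d m. N \<le> m \<and> 0 < d \<and> d \<le> m \<and> \<rho> * real d \<le> real m \<and>
    (\<forall>j. j + d < m \<longrightarrow> morph_inf f w (s + j + d) = morph_inf f w (s + j))"
  proof (intro exI conjI allI impI)
    show "N \<le> S s (s + d + l)" using big[of "s + d + l" s] *(1) by simp
    show "0 < S s (s + d)" using big[of "s + d" s] *(2) by simp
    show "S s (s + d) \<le> S s (s + d + l)" using split by simp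
    show "\<rho> * real (S s (s + d)) \<le> real (S s (s + d + l))" using *(4) by (simp add: S_def)
    fix j assume "j + S s (s + d) < S s (s + d + l)"
    then have "j < S s (s + l)" using split shift by simp
    then show "morph_inf f w (H s + j + S s (s + d)) = morph_inf f w (H s + j)"
      unfolding H_def S_def using morph_inf_periodic[of f s l w d j] ne *(3) by blast
  qed
qed

text \<open>The first letter of an image tells which letter was coded, so a word can be decoded from
  the left.\<close>

lemma inj_morph_replicate:
  assumes "\<alpha> \<noteq> \<beta>" "0 < L"
  shows "inj (morph (\<lambda>y. if y then replicate L \<beta> else [\<alpha>]))" (is "inj (morph ?f)")
proof -
  have "morph ?f u = morph ?f v \<Longrightarrow> u = v" for u v
  proof (induction u arbitrary: v)
    case Nil
    then show ?case using assms by (cases v) (auto simp: morph_def split: if_splits)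
  next
    case (Cons y u)
    obtain L' where L: "L = Suc L'" using assms by (cases L) auto
    from Cons.prems L obtain z v' where v: "v = z # v'"
      by (cases v) (auto simp: morph_def split: if_splits)
    have "z = y" using Cons.prems v L assms by (auto simp: morph_def split: if_splits)
    moreover have "morph ?f u = morph ?f v'" using Cons.prems v \<open>z = y\<close> by (auto simp: morph_def)
    ultimately show ?case using Cons.IH v by simp
  qed
  then show ?thesis by (auto intro: injI)
qed

section \<open>The word and its repetitions\<close>

lemma ex_mod_eq_in_window:
  fixes y M r :: nat
  assumes "r < M"
  obtains x where "y \<le> x" "x < y + M" "x mod M = r"
proof
  \<comment> \<open>This is \<open>r - y\<close> modulo \<open>M\<close>, arranged to stay within
    the natural numbers.\<close>
  let ?k = "(r + (M - y mod M)) mod M"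
  show "y \<le> y + ?k" by simp
  show "y + ?k < y + M" using assms by simp
  have "(y + ?k) mod M = (y mod M + (r + (M - y mod M))) mod M"
    by (simp add: mod_simps)
  also have "y mod M + (r + (M - y mod M)) = r + M"
    using assms mod_less_divisor[of M y] by linarith
  finally show "(y + ?k) mod M = r" using assms by simp
qed

lemma mod_power_lower:
  fixes x :: nat
  assumes "x mod 2 ^ g = z" "f \<le> g"
  shows "x mod 2 ^ f = z mod 2 ^ f"
  using assms by (metis le_imp_power_dvd mod_mod_cancel)

text \<open>The equation \<open>x mod 2 ^ (f + 1) = 2 ^ f\<close> encodes that \<open>x\<close> has
  2-adic valuation \<open>f\<close>; a larger power \<open>2 ^ g\<close> vanishes modulo
  \<open>2 ^ (f + 1)\<close>.\<close>

lemma two_adic_val_unique: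
  fixes x :: nat
  assumes "x mod 2 ^ (f + 1) = 2 ^ f" "x mod 2 ^ (g + 1) = 2 ^ g"
  shows "f = g"
proof -
  have False if "x mod 2 ^ (f + 1) = 2 ^ f" "x mod 2 ^ (g + 1) = 2 ^ g" "f < g" for f g
  proof -
    have "x mod 2 ^ (f + 1) = 2 ^ g mod 2 ^ (f + 1)"
      using that mod_power_lower[of x "g + 1" _ "f + 1"] by simp
    also have "\<dots> = 0" using that(3) le_imp_power_dvd[of "f + 1" g "2::nat"] by simp
    finally show False using that(1) by simp
  qed
  then show ?thesis using assms by (metis nat_neq_iff)
qed

text \<open>No carry reaches bit \<open>e\<close>, as \<open>d\<close> has no bits below it; the
  quotient changes by the odd number \<open>d div 2 ^ e\<close>.\<close>

lemma odd_div_add_iff: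
  fixes x d :: nat
  assumes "2 ^ e dvd d" "\<not> 2 ^ (e + 1) dvd d"
  shows "odd ((x + d) div 2 ^ e) \<longleftrightarrow> even (x div 2 ^ e)"
proof -
  obtain q where q: "d = 2 ^ e * q" using assms(1) by blast
  have "odd q" using assms(2) q by (auto elim!: evenE)
  have "(x + d) div 2 ^ e = x div 2 ^ e + q" using q by simp
  then show ?thesis using \<open>odd q\<close> by simp
qed

lemma even_div_add_iff:
  fixes x d :: nat
  assumes "2 ^ (e + 1) dvd d"
  shows "odd ((x + d) div 2 ^ e) \<longleftrightarrow> odd (x div 2 ^ e)"
proof -
  obtain q where q: "d = 2 ^ e * (2 * q)" using assms by (auto simp: ac_simps)
  have "(x + d) div 2 ^ e = x div 2 ^ e + 2 * q" using q by simp
  then show ?thesis by simp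
qed

lemma mod_add_dvd:
  fixes x d M :: nat
  assumes "M dvd d"
  shows "(x + d) mod M = x mod M"
  using assms by auto

lemma add_mod_0_imp_eq:
  fixes u r M :: nat
  assumes "(u + r) mod M = 0" "u < M" "0 < r" "r < M"
  shows "u + r = M"
proof -
  obtain k where k: "u + r = M * k" using assms(1) by (auto elim: dvdE simp: mod_eq_0_iff_dvd)
  have "M * k < M * 2" using k assms by linarith
  then have "k < 2" by simp
  moreover have "k \<noteq> 0" using k assms by (intro notI) simp
  ultimately have "k = 1" by linarith
  then show ?thesis using k by simp
qed

section \<open>Definition of the word\<close>

text \<open>The intended repetitions have exponent \<open>n + 1 / 2 ^ a\<close>, \<open>t\<close>
  controls the length of unintended ones, \<open>2 ^ b\<close> is the spacing of deviations and
  \<open>2 ^ G\<close> the ratio of successive scales. The bounds on \<open>G\<close> make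
  \<open>D k\<close> and \<open>p k\<close> multiples of \<open>2 ^ b\<close>, keep deviations of
  valuation up to \<open>b + 1\<close> from being switched off, and separate the zones.\<close>

locale toeplitz_params =
  fixes n a t b G :: nat
  assumes n1: "1 \<le> n" and t1: "1 \<le> t" and b2: "2 \<le> b" and a1: "1 \<le> a"
    and G_ab: "a + b \<le> G" and G_bt: "b + t + 2 \<le> G"
    and G_n: "(n + 2) * 2 ^ (t + 2) \<le> 2 ^ G"
begin

definition D :: "nat \<Rightarrow> nat" where "D k = 2 ^ (G * k)"

definition p :: "nat \<Rightarrow> nat" where "p k = 2 ^ (G * k - a)"

text \<open>The stretch of the intended repetition: \<open>n\<close> periods of length
  \<open>D k\<close> and the head, of length \<open>p k\<close>, of one more.\<close>

definition zone :: "nat \<Rightarrow> nat \<Rightarrow> bool" where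
  "zone k x \<longleftrightarrow> 1 \<le> k \<and> D k \<le> x \<and> x < (n + 1) * D k + p k"

definition low :: "nat \<Rightarrow> bool" where
  "low x \<longleftrightarrow> (\<exists>k m. 1 \<le> k \<and> 1 \<le> m \<and> m \<le> n \<and> m * D k + p k \<le> x \<and> x < (m + 1) * D k)"

text \<open>Valuation \<open>b\<close> carries markers of fixed period
  \<open>2 ^ (b + t + 1)\<close>, a clock against distances of low valuation; a higher valuation
  \<open>f\<close> reads bit \<open>f + t\<close>. In zone \<open>k\<close> the bits from
  \<open>G * k\<close> on are ignored, because adding \<open>D k\<close> can change them.\<close>

definition c :: "nat \<Rightarrow> bool" where
  "c x \<longleftrightarrow> x mod 2 ^ (b + t + 1) = 2 ^ b \<or>
    (\<exists>f>b. x mod 2 ^ (f + 1) = 2 ^ f \<and> odd (x div 2 ^ (f + t)) \<and>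
      \<not> (\<exists>k. zone k x \<and> G * k \<le> f + t))"

definition w :: "nat \<Rightarrow> bool" where "w x \<longleftrightarrow> (low x \<longleftrightarrow> c x)"

lemma G_le: "1 \<le> k \<Longrightarrow> G \<le> G * k"
  by simp

lemma p_D: "1 \<le> k \<Longrightarrow> p k * 2 ^ a = D k"
proof -
  assume "1 \<le> k"
  then have "a \<le> G * k" using G_le[of k] G_ab by linarith
  then show ?thesis by (simp add: p_def D_def flip: power_add)
qed

lemma p_le: "1 \<le> k \<Longrightarrow> 2 * p k \<le> D k"
proof -
  assume "1 \<le> k"
  have "(2::nat) ^ 1 \<le> 2 ^ a" using a1 by (intro power_increasing) auto
  then have "p k * 2 \<le> p k * 2 ^ a" by simp
  then show ?thesis using p_D[OF \<open>1 \<le> k\<close>] by simp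
qed

lemma p_pos: "p k > 0" by (simp add: p_def)

lemma D_pos: "D k > 0" by (simp add: D_def)

lemma D_mono: "k \<le> k' \<Longrightarrow> D k \<le> D k'"
  unfolding D_def by (intro power_increasing) auto

lemma D_Suc: "D (Suc k) = 2 ^ G * D k"
  by (simp add: D_def power_add)

lemma D_Suc_ge: "(n + 2) * 2 ^ (t + 2) * D k \<le> D (Suc k)"
  using mult_right_mono[OF G_n, of "D k"] by (simp add: D_Suc)

lemma D_ge: "k \<le> D k"
proof -
  have "G \<ge> 1" using G_bt by simp
  then have "k \<le> G * k" by simp
  also have "G * k < 2 ^ (G * k)" by (rule less_exp)
  finally show ?thesis by (simp add: D_def)
qed

lemma block_dvd_D: "1 \<le> k \<Longrightarrow> 2 ^ b dvd D k"
  unfolding D_def using G_le[of k] G_ab by (intro le_imp_power_dvd) linarith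

lemma block_dvd_p: "1 \<le> k \<Longrightarrow> 2 ^ b dvd p k"
  unfolding p_def using G_le[of k] G_ab by (intro le_imp_power_dvd) linarith

lemma block_ge_4: "(4::nat) \<le> 2 ^ b"
  using b2 power_increasing[of 2 b "2::nat"] by simp

lemma block_le_iff:
  fixes x y z :: nat
  assumes "x div 2 ^ b = y div 2 ^ b" "2 ^ b dvd z"
  shows "z \<le> x \<longleftrightarrow> z \<le> y"
proof -
  have "z \<le> u \<longleftrightarrow> z div 2 ^ b \<le> u div 2 ^ b" for u
    using assms(2) by (metis div_le_mono dvd_mult_div_cancel less_eq_div_iff_mult_less_eq mult.commute zero_less_numeral zero_less_power)
  then show ?thesis using assms(1) by simp
qed

text \<open>All end points in \<open>low\<close> are multiples of \<open>2 ^ b\<close>. Since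
  deviations occur only at block starts, comparing a block start with its successor separates
  \<open>c\<close> from \<open>low\<close>.\<close>

lemma low_block:
  assumes "x div 2 ^ b = y div 2 ^ b"
  shows "low x \<longleftrightarrow> low y"
proof -
  have "m * D k + p k \<le> x \<and> x < (m + 1) * D k \<longleftrightarrow> m * D k + p k \<le> y \<and> y < (m + 1) * D k"
    if "1 \<le> k" for k m
    using block_le_iff[OF assms, of "m * D k + p k"] block_le_iff[OF assms, of "(m + 1) * D k"]
      block_dvd_D[OF that] block_dvd_p[OF that] by (simp add: not_le[symmetric])
  then show ?thesis unfolding low_def by blast
qed

lemma low_Suc: "Suc x mod 2 ^ b \<noteq> 0 \<Longrightarrow> low (Suc x) \<longleftrightarrow> low x"
  by (intro low_block) (simp add: div_Suc)

lemma c_dvd: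
  assumes "c x"
  shows "x mod 2 ^ b = 0"
proof -
  obtain f where "b \<le> f" "x mod 2 ^ (f + 1) = 2 ^ f"
    using assms mod_power_lower[of x "b + t + 1" _ "b + 1"] unfolding c_def by fastforce
  then show ?thesis
    using mod_power_lower[of x "f + 1" "2 ^ f" b] by (simp add: le_imp_power_dvd)
qed

lemma no_zone_small: "f + t < G \<Longrightarrow> \<not> (\<exists>k. zone k x \<and> G * k \<le> f + t)"
  using G_le by (fastforce simp: zone_def)

lemma c_at_block:
  assumes "x mod 2 ^ (b + 1) = 2 ^ b"
  shows "c x \<longleftrightarrow> x mod 2 ^ (b + t + 1) = 2 ^ b"
  using two_adic_val_unique[OF assms] unfolding c_def by auto

lemma c_at_val:
  assumes "x mod 2 ^ (f + 1) = 2 ^ f" "b < f"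
  shows "c x \<longleftrightarrow> odd (x div 2 ^ (f + t)) \<and> \<not> (\<exists>k. zone k x \<and> G * k \<le> f + t)"
proof -
  have "x mod 2 ^ (b + t + 1) \<noteq> 2 ^ b"
  proof
    assume "x mod 2 ^ (b + t + 1) = 2 ^ b"
    then have "x mod 2 ^ (b + 1) = 2 ^ b"
      using mod_power_lower[of x "b + t + 1" _ "b + 1"] by simp
    then show False using two_adic_val_unique[OF assms(1)] assms(2) by blast
  qed
  then show ?thesis unfolding c_def using two_adic_val_unique[OF assms(1)] assms by metis
qed

section \<open>Agreement lengths by the 2-adic valuation of the distance\<close>

abbreviation agree :: "nat \<Rightarrow> nat \<Rightarrow> nat \<Rightarrow> bool" where
  "agree i d l \<equiv> (\<forall>x. i \<le> x \<longrightarrow> x < i + l \<longrightarrow> w x = w (x + d))"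

lemma agreeD:
  assumes "agree i d l" "i \<le> x" "Suc x < i + l"
  shows "w x = w (x + d)" "w (Suc x) = w (Suc (x + d))"
  using assms(1)[rule_format, of x] assms(1)[rule_format, of "Suc x"] assms(2,3) by simp_all

text \<open>At a block start, the successor carries no deviation on either side, so it reveals
  \<open>low\<close> for its block and then \<open>w\<close> reveals \<open>c\<close>. At other
  positions \<open>c\<close> is false. The successor must therefore lie in the window too.\<close>

lemma agree_flags:
  assumes "agree i d l" "2 ^ b dvd d" "i \<le> x" "x + 1 < i + l"
  shows "low x \<longleftrightarrow> low (x + d)" and "c x \<longleftrightarrow> c (x + d)"
proof -
  have eq: "w x = w (x + d)" "w (Suc x) = w (Suc (x + d))" using agreeD[OF assms(1,3)] assms(4) by simp_all
  have m: "(x + d) mod 2 ^ b = x mod 2 ^ b" "Suc (x + d) mod 2 ^ b = Suc x mod 2 ^ b"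
    using assms(2) mod_add_dvd[of "2 ^ b" d] mod_add_dvd[of "2 ^ b" d "Suc x"] by auto
  have "(low x \<longleftrightarrow> low (x + d)) \<and> (c x \<longleftrightarrow> c (x + d))"
  proof (cases "x mod 2 ^ b = 0")
    case True
    then have s: "Suc x mod 2 ^ b \<noteq> 0" using block_ge_4 by (simp add: mod_Suc)
    then have "\<not> c (Suc x)" "\<not> c (Suc (x + d))" using c_dvd m by auto
    then have "low (Suc x) \<longleftrightarrow> low (Suc (x + d))" using eq(2) by (simp add: w_def)
    then have "low x \<longleftrightarrow> low (x + d)" using low_Suc s m by metis
    then show ?thesis using eq(1) by (auto simp: w_def)
  next
    case False
    then have "\<not> c x" "\<not> c (x + d)" using c_dvd m by auto
    then show ?thesis using eq(1) by (auto simp: w_def)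
  qed
  then show "low x \<longleftrightarrow> low (x + d)" "c x \<longleftrightarrow> c (x + d)" by auto
qed

lemma ex_marker:
  obtains x where "y \<le> x" "x < y + 2 ^ (b + t + 1)" "x mod 2 ^ (b + t + 1) = 2 ^ b"
    "x mod 2 ^ (b + 1) = 2 ^ b" "c x" "x mod 2 ^ b = 0"
proof -
  have "(2::nat) ^ b < 2 ^ (b + t + 1)" by (intro power_strict_increasing) auto
  then obtain x where x: "y \<le> x" "x < y + 2 ^ (b + t + 1)" "x mod 2 ^ (b + t + 1) = 2 ^ b"
    by (rule ex_mod_eq_in_window)
  moreover have "c x" using x by (simp add: c_def)
  ultimately show ?thesis
    using that[of x] c_dvd[of x] mod_power_lower[of x "b + t + 1" _ "b + 1"] by simp
qed

text \<open>At a marker \<open>w\<close> differs from its value at the successor, while the two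
  positions at distance \<open>d\<close> lie inside one block without deviations, so
  \<open>w\<close> is equal there.\<close>

lemma agree_unaligned:
  assumes "agree i d l" "\<not> 2 ^ b dvd d"
  shows "l \<le> 2 ^ (b + t + 1) + 1"
proof (rule ccontr)
  assume "\<not> ?thesis"
  then have l: "2 ^ (b + t + 1) + 2 \<le> l" by simp
  define r where "r = d mod 2 ^ b"
  have r: "0 < r" "r < 2 ^ b" using assms(2) by (auto simp: r_def dvd_eq_mod_eq_0)
  show False
  proof (cases "Suc r = 2 ^ b")
    case False
    obtain x where x: "i \<le> x" "x < i + 2 ^ (b + t + 1)" "c x" "x mod 2 ^ b = 0"
      using ex_marker[of i] by metis
    have "(x + d) mod 2 ^ b = r" using x by (simp add: r_def mod_add_eq[symmetric])
    then have m: "(x + d) mod 2 ^ b \<noteq> 0" "Suc (x + d) mod 2 ^ b \<noteq> 0" "Suc x mod 2 ^ b \<noteq> 0"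
      using r False x block_ge_4 by (simp_all add: mod_Suc)
    have "w x = w (x + d)" "w (Suc x) = w (Suc (x + d))"
      using agreeD[OF assms(1) x(1)] x l by simp_all
    moreover have "\<not> c (x + d)" "\<not> c (Suc (x + d))" "\<not> c (Suc x)" using m c_dvd by auto
    ultimately show False using low_Suc m x(3) unfolding w_def by metis
  next
    case True
    \<comment> \<open>Shifted by \<open>d\<close>, a block start and its successor would straddle a
      block border, so the marker is placed at \<open>y = x + d\<close> instead. Then
      \<open>x\<close> has residue 1, and \<open>x\<close> and \<open>x + 1\<close> share a
      block.\<close>
    obtain y where y: "i + d \<le> y" "y < i + d + 2 ^ (b + t + 1)" "c y" "y mod 2 ^ b = 0"
      using ex_marker[of "i + d"] by metis
    define x where "x = y - d"
    have xd: "x + d = y" "i \<le> x" "x < i + 2 ^ (b + t + 1)" using y by (auto simp: x_def)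
    have "(x mod 2 ^ b + r) mod 2 ^ b = 0" using y xd by (simp add: r_def mod_simps)
    moreover have "x mod 2 ^ b < 2 ^ b" by simp
    ultimately have "x mod 2 ^ b + r = 2 ^ b"
      using r by (intro add_mod_0_imp_eq)
    then have "x mod 2 ^ b = 1" using True by linarith
    then have m: "x mod 2 ^ b \<noteq> 0" "Suc x mod 2 ^ b \<noteq> 0" "Suc y mod 2 ^ b \<noteq> 0"
      using y block_ge_4 by (simp_all add: mod_Suc)
    have "Suc x < i + l" using xd l by linarith
    then have "w x = w y" "w (Suc x) = w (Suc y)"
      using agreeD[OF assms(1) xd(2)] xd(1) by simp_all
    moreover have "\<not> c x" "\<not> c (Suc y)" "\<not> c (Suc x)" using m c_dvd by auto
    ultimately show False using low_Suc m y(3) unfolding w_def by metis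
  qed
qed

text \<open>The shift by \<open>2 ^ (b + t + 1)\<close> keeps \<open>c x\<close> but flips \<open>c (x + d)\<close>.\<close>

lemma agree_odd_block:
  assumes "agree i d l" "2 ^ b dvd d" "\<not> 2 ^ (b + 1) dvd d"
  shows "l \<le> 3 * 2 ^ (b + t + 1) + 1"
proof (rule ccontr)
  assume "\<not> ?thesis"
  then have l: "3 * 2 ^ (b + t + 1) + 2 \<le> l" by simp
  have t2: "(2::nat) ^ (b + 2) \<le> 2 * 2 ^ (b + t + 1)"
    using power_increasing[of "b + 2" "b + t + 2" "2::nat"] by simp
  \<comment> \<open>As \<open>d\<close> has valuation \<open>b\<close>, choosing
    \<open>y = x + d\<close> of valuation \<open>b + 1\<close> gives \<open>x\<close> valuation
    \<open>b\<close>: the two ends follow different clauses of \<open>c\<close>.\<close>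
  have "(2::nat) ^ (b + 1) < 2 ^ (b + 1 + 1)" by simp
  then obtain y where y: "i + d \<le> y" "y < i + d + 2 ^ (b + 1 + 1)" "y mod 2 ^ (b + 1 + 1) = 2 ^ (b + 1)"
    by (rule ex_mod_eq_in_window)
  define x where "x = y - d"
  have xd: "x + d = y" "i \<le> x" "x < i + 2 * 2 ^ (b + t + 1)" using y t2 by (auto simp: x_def simp del: power_Suc power_add)
  have db: "d mod 2 ^ (b + 1) = 2 ^ b"
  proof -
    obtain q where q: "d = 2 ^ b * q" using assms(2) by blast
    have "odd q" using assms(3) q by (auto elim!: evenE)
    then show ?thesis using q by (simp add: mod_mult_mult1 odd_iff_mod_2_eq_one)
  qed
  have xb: "x mod 2 ^ (b + 1) = 2 ^ b"
  proof -
    have "y mod 2 ^ (b + 1) = 0" using mod_power_lower[OF y(3), of "b + 1"] by simp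
    then have "(x mod 2 ^ (b + 1) + 2 ^ b) mod 2 ^ (b + 1) = 0"
      using xd(1) db by (metis mod_add_eq)
    moreover have "x mod 2 ^ (b + 1) < 2 ^ (b + 1)" by simp
    ultimately have "x mod 2 ^ (b + 1) + 2 ^ b = 2 ^ (b + 1)" by (intro add_mod_0_imp_eq) auto
    then show ?thesis by simp
  qed
  let ?s = "2 ^ (b + t + 1) :: nat"
  have "c x = c y" using agree_flags(2)[OF assms(1,2), of x] xd l by auto
  moreover have "c (x + ?s) = c (y + ?s)"
    using agree_flags(2)[OF assms(1,2), of "x + ?s"] xd l by (auto simp: ac_simps)
  moreover have "c (x + ?s) = c x"
  proof -
    have "(x + ?s) mod 2 ^ (b + 1) = 2 ^ b" using xb by (simp add: mod_add_dvd le_imp_power_dvd)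
    then show ?thesis using c_at_block xb by simp
  qed
  moreover have "c (y + ?s) \<longleftrightarrow> \<not> c y"
  proof -
    have "(2::nat) ^ (b + 1 + 1) dvd ?s" using t1 by (intro le_imp_power_dvd) simp
    then have "(y + ?s) mod 2 ^ (b + 1 + 1) = 2 ^ (b + 1)" using y(3) mod_add_dvd by metis
    moreover have "odd ((y + ?s) div 2 ^ (b + t + 1)) \<longleftrightarrow> even (y div 2 ^ (b + t + 1))"
      by (rule odd_div_add_iff) auto
    moreover have "\<not> (\<exists>k. zone k z \<and> G * k \<le> b + 1 + t)" for z
      using G_bt by (intro no_zone_small) simp
    ultimately show ?thesis using c_at_val[of _ "b + 1"] y(3) by (simp add: ac_simps)
  qed
  ultimately show False by blast
qed

text \<open>The shift takes a marker to another position of valuation \<open>b\<close>, which is a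
  marker only if \<open>d\<close> is a multiple of the marker period.\<close>

lemma agree_small_val:
  assumes "agree i d l" "2 ^ (b + 1) dvd d" "\<not> 2 ^ (b + t + 1) dvd d"
  shows "l \<le> 2 ^ (b + t + 1) + 1"
proof (rule ccontr)
  assume "\<not> ?thesis"
  then have l: "2 ^ (b + t + 1) + 2 \<le> l" by simp
  obtain x where x: "i \<le> x" "x < i + 2 ^ (b + t + 1)" "x mod 2 ^ (b + t + 1) = 2 ^ b"
    "x mod 2 ^ (b + 1) = 2 ^ b" "c x"
    using ex_marker[of i] by metis
  have "2 ^ b dvd d" using assms(2) by (meson dvd_trans le_imp_power_dvd le_add1)
  then have "c (x + d)" using agree_flags(2)[OF assms(1), of x] x l by auto
  moreover have "(x + d) mod 2 ^ (b + 1) = 2 ^ b" using x(4) assms(2) mod_add_dvd by metis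
  ultimately have "(x + d) mod 2 ^ (b + t + 1) = x mod 2 ^ (b + t + 1)" using c_at_block x(3) by simp
  then have "2 ^ (b + t + 1) dvd d" by (simp add: mod_eq_dvd_iff_nat)
  then show False using assms(3) by blast
qed

text \<open>The shift keeps the valuation \<open>e - t\<close> and flips bit \<open>e\<close>, the
  one read at that valuation. Hence at least one of the two ends must have its deviation switched
  off.\<close>

lemma agree_high_val:
  assumes "agree i d l" "2 ^ e dvd d" "\<not> 2 ^ (e + 1) dvd d" "b + t < e"
    and x: "i \<le> x" "x + 1 < i + l" "x mod 2 ^ (e - t + 1) = 2 ^ (e - t)"
  shows "\<exists>k. (zone k x \<or> zone k (x + d)) \<and> G * k \<le> e"
proof (rule ccontr)
  assume no: "\<not> ?thesis"
  have "2 ^ b dvd d" using assms(2,4) by (meson dvd_trans le_imp_power_dvd less_or_eq_imp_le add_leD1)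
  then have "c x = c (x + d)" using agree_flags(2)[OF assms(1)] x by blast
  moreover have "(2::nat) ^ (e - t + 1) dvd 2 ^ e" using t1 assms(4) by (intro le_imp_power_dvd) simp
  then have "(x + d) mod 2 ^ (e - t + 1) = 2 ^ (e - t)" using x(3) assms(2) mod_add_dvd by (metis dvd_trans)
  moreover have "odd ((x + d) div 2 ^ e) \<longleftrightarrow> even (x div 2 ^ e)"
    using assms(2,3) by (rule odd_div_add_iff)
  moreover have "b < e - t" "e - t + t = e" using assms(4) by auto
  ultimately show False
    using c_at_val[of x "e - t"] c_at_val[of "x + d" "e - t"] x(3) no by (simp, blast)
qed

end

section \<open>Counting periods around one zone\<close>

text \<open>Arithmetic core for distance \<open>q * D\<close>: by \<open>hit\<close>, every window
  of length \<open>S\<close> has a point that lies in the zone, itself or after the shift; by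
  \<open>flag\<close>, low stretches match. A block \<open>m\<close> whose flag differs from that of
  block \<open>m + q\<close> stops the interval. The extreme case is \<open>q = 1\<close>, where
  blocks 1 to \<open>n - 1\<close> match.\<close>

lemma flag_interval_bound:
  fixes n q D p S i j :: nat
  assumes n: "1 \<le> n" and q: "1 \<le> q" and p: "p < D"
    and hit: "\<And>y. i \<le> y \<Longrightarrow> y + S \<le> j \<Longrightarrow> \<exists>x. y \<le> x \<and> x < y + S \<and>
      (D \<le> x \<and> x < (n + 1) * D + p \<or> D \<le> x + q * D \<and> x + q * D < (n + 1) * D + p)"
    and flag: "\<And>x. i \<le> x \<Longrightarrow> x + 1 < j \<Longrightarrow> p \<le> x mod D \<Longrightarrow>
      1 \<le> x div D \<and> x div D \<le> n \<longleftrightarrow> x div D + q \<le> n"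
    and j: "j \<le> (n + 1) * D + p + S"
  shows "j \<le> i + (n - 1) * (q * D) + 2 * p + S + 1"
proof -
  have D: "0 < D" using p by simp
  \<comment> \<open>The first point of block \<open>m\<close> in the interval with offset at least
    \<open>p\<close> would violate \<open>flag\<close>.\<close>
  have stop: "j \<le> max i (m * D + p) + 1"
    if "i < (m + 1) * D" "\<not> (1 \<le> m \<and> m \<le> n \<longleftrightarrow> m + q \<le> n)" for m
  proof (rule ccontr)
    let ?x = "max i (m * D + p)"
    assume "\<not> ?thesis"
    then have *: "?x + 1 < j" by simp
    have "m * D \<le> ?x" "?x < Suc m * D" using that(1) p by auto
    then have xd: "?x div D = m" by (intro div_nat_eqI) (auto simp: mult.commute)
    have "?x = m * D + ?x mod D" using div_mult_mod_eq[of ?x D] xd by simp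
    then have "p \<le> ?x mod D" by linarith
    then show False using flag[of ?x] * xd that(2) by simp
  qed
  define m where "m = i div D"
  have m: "m * D \<le> i" "i < (m + 1) * D"
    using D by (auto simp: m_def div_times_less_eq_dividend dividend_less_div_times add.commute)
  have mult_le: "u * D \<le> i" if "u \<le> m" for u
    using mult_le_mono1[OF that, of D] m(1) by linarith
  show ?thesis
  proof (cases "q \<le> n")
    case True
    \<comment> \<open>Blocks 1 to \<open>r\<close> match; block 0 and blocks \<open>r + 1\<close> to
      \<open>n\<close> do not. A start beyond block \<open>r + 1\<close> is handled by the bound on
      \<open>j\<close>.\<close>
    then obtain r where r: "n = q + r" using le_Suc_ex by blast
    have r_le: "r * D \<le> (n - 1) * (q * D)"
    proof -
      have "r * 1 \<le> (n - 1) * q" using r q by (intro mult_mono) auto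
      then show ?thesis using mult_le_mono1[of r "(n - 1) * q" D] by simp
    qed
    have q_le: "(q - 1) * D \<le> (n - 1) * (q * D)"
    proof -
      have "(q - 1) * 1 \<le> (n - 1) * q" using r q by (intro mult_mono) auto
      then show ?thesis using mult_le_mono1[of "q - 1" "(n - 1) * q" D] by simp
    qed
    consider "m = 0" | "1 \<le> m" "m \<le> r + 1" | "r + 2 \<le> m" by linarith
    then show ?thesis
    proof cases
      case 1
      then show ?thesis using stop[of 0] m True by auto
    next
      case 2
      have "(m + 1) * D \<le> (r + 1 + 1) * D" using 2 by (intro mult_le_mono1) simp
      then have "j \<le> max i ((r + 1) * D + p) + 1"
        using m(2) r q by (intro stop) auto
      moreover have "D \<le> i" using mult_le[of 1] 2 by simp
      ultimately show ?thesis using r_le by (auto simp: max_def algebra_simps split: if_splits)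
    next
      case 3
      have "(r + 2) * D \<le> i" using mult_le 3 by blast
      moreover have "(n + 1) * D = (r + 2) * D + (q - 1) * D"
      proof -
        have "n + 1 = (r + 2) + (q - 1)" using r q by simp
        then show ?thesis by (simp only: add_mult_distrib)
      qed
      ultimately show ?thesis using j q_le by linarith
    qed
  next
    case False
    consider "m = 0" | "1 \<le> m" "m \<le> n" | "n + 1 \<le> m" by linarith
    then show ?thesis
    proof cases
      case 1
      \<comment> \<open>Block 0 matches here, but block 1 does not. From offset \<open>p\<close> on,
        the shift by \<open>q * D\<close> with \<open>q > n\<close> lands past the zone, so
        \<open>hit\<close> forces \<open>D\<close> to be within \<open>S\<close> of
        \<open>max i p\<close>. This causes the second \<open>p\<close> in the bound.\<close>
      have iD: "i < D" using 1 m by simp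
      have j1: "j \<le> D + p + 1" using stop[of 1] iD False n by auto
      let ?y = "max i p"
      show ?thesis
      proof (cases "?y + S \<le> j")
        case True
        obtain x where x: "?y \<le> x" "x < ?y + S"
          "D \<le> x \<and> x < (n + 1) * D + p \<or> D \<le> x + q * D \<and> x + q * D < (n + 1) * D + p"
          using hit[OF _ True] by auto
        have "(n + 1) * D \<le> q * D" using False by (intro mult_le_mono1) simp
        then have "D \<le> x" using x by linarith
        then show ?thesis using x j1 by (auto simp: max_def split: if_splits)
      qed (auto simp: max_def split: if_splits)
    next
      case 2
      then have "j \<le> max i (m * D + p) + 1" using m False by (intro stop) auto
      then show ?thesis using m by (auto simp: max_def split: if_splits)
    next
      case 3
      then show ?thesis using mult_le[of "n + 1"] j by simp
    qed
  qed
qed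

lemma ex_two_adic_val:
  fixes d :: nat
  assumes "0 < d"
  obtains e where "2 ^ e dvd d" "\<not> 2 ^ (e + 1) dvd d"
proof -
  define m where "m = (LEAST m. \<not> 2 ^ m dvd d)"
  have "\<not> 2 ^ d dvd d" using assms less_exp[of d] dvd_imp_le[of "2 ^ d" d] by linarith
  then have m: "\<not> 2 ^ m dvd d" unfolding m_def by (rule LeastI)
  then obtain e where e: "m = Suc e" by (cases m) auto
  have "2 ^ e dvd d" using e not_less_Least[of e "\<lambda>m. \<not> 2 ^ m dvd d"] by (simp add: m_def)
  then show ?thesis using that m e by simp
qed

section \<open>Bound on all agreement lengths\<close>

context toeplitz_params
begin

lemma zone_less: "zone k x \<Longrightarrow> x < (n + 2) * D k"
  using p_le[of k] by (auto simp: zone_def)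

text \<open>Low stretches of smaller scales end before this range and those of larger scales start
  after it, so scale \<open>K\<close> alone decides.\<close>

lemma low_iff:
  assumes "1 \<le> K" "(n + 2) * D (K - 1) \<le> x" "x < D (K + 1)"
  shows "low x \<longleftrightarrow> 1 \<le> x div D K \<and> x div D K \<le> n \<and> p K \<le> x mod D K"
proof
  assume "low x"
  then obtain k m where km: "1 \<le> k" "1 \<le> m" "m \<le> n" "m * D k + p k \<le> x" "x < (m + 1) * D k"
    unfolding low_def by blast
  have "\<not> k < K"
  proof
    assume "k < K"
    then have "(m + 1) * D k \<le> (n + 2) * D (K - 1)" using km by (intro mult_le_mono D_mono) auto
    then show False using km assms by linarith
  qed
  moreover have "\<not> K < k"
  proof
    assume "K < k"
    then have "D (K + 1) \<le> D k" by (intro D_mono) simp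
    also have "\<dots> \<le> m * D k" using km by simp
    finally show False using km assms by linarith
  qed
  ultimately have [simp]: "k = K" by simp
  have xd: "x div D K = m" using km by (intro div_nat_eqI) (auto simp: mult.commute)
  then have "x = m * D K + x mod D K" using div_mult_mod_eq[of x "D K"] by simp
  then have "p K \<le> x mod D K" using km by simp
  then show "1 \<le> x div D K \<and> x div D K \<le> n \<and> p K \<le> x mod D K" using km xd by simp
next
  assume *: "1 \<le> x div D K \<and> x div D K \<le> n \<and> p K \<le> x mod D K"
  have "x = x div D K * D K + x mod D K" by (simp only: div_mult_mod_eq)
  moreover have "x mod D K < D K" by (simp add: D_pos)
  ultimately have "x div D K * D K + p K \<le> x" "x < (x div D K + 1) * D K"
    using * by (simp_all only: add_mult_distrib) linarith+
  then show "low x" unfolding low_def using * assms(1) by blast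
qed

lemma D_pred_le: "1 \<le> K \<Longrightarrow> (n + 2) * 2 ^ (t + 2) * D (K - 1) \<le> D K"
  using D_Suc_ge[of "K - 1"] by simp

text \<open>Distances of valuation at most \<open>b + t\<close> cost a constant. Otherwise the
  deviations force contact with a zone, and only the largest possible scale \<open>K\<close> allows
  a long agreement, measured by \<open>flag_interval_bound\<close>. The error \<open>u\<close> comes
  from heads, \<open>v\<close> from the spacing of deviations and from other short ranges.\<close>

lemma agree_bound:
  assumes agr: "agree i d l" and d: "0 < d"
  shows "\<exists>u v. l \<le> (n - 1) * d + 2 * u + v + (3 * 2 ^ (b + t + 1) + 3) \<and>
    u * 2 ^ a \<le> d \<and> v * 2 ^ t \<le> 4 * d"
proof -
  have const: ?thesis if "l \<le> 3 * 2 ^ (b + t + 1) + 1"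
    using that by (intro exI[of _ 0]) auto
  obtain e where e: "2 ^ e dvd d" "\<not> 2 ^ (e + 1) dvd d" using ex_two_adic_val[OF d] .
  show ?thesis
  proof (cases "b + t < e")
    case False
    consider "\<not> 2 ^ b dvd d" | "2 ^ b dvd d" "\<not> 2 ^ (b + 1) dvd d" |
      "2 ^ (b + 1) dvd d" "\<not> 2 ^ (b + t + 1) dvd d"
      using e False by (meson dvd_trans le_imp_power_dvd add_le_mono1 not_less)
    then show ?thesis
      using const agree_unaligned[OF agr] agree_odd_block[OF agr] agree_small_val[OF agr]
      by cases fastforce+
  next
    case True
    define u where "u = (2::nat) ^ (e - t)"
    \<comment> \<open>Room for a point of valuation \<open>e - t\<close> and its successor.\<close>
    define S where "S = 2 * u + 2"
    have "u * 2 ^ t = 2 ^ e" using True by (simp add: u_def flip: power_add)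
    then have ud: "u * 2 ^ t \<le> d" using e d by (simp add: dvd_imp_le)
    have hit0: "\<exists>x k. y \<le> x \<and> x + 1 < y + S \<and> (zone k x \<or> zone k (x + d)) \<and> G * k \<le> e"
      if "i \<le> y" "y + S \<le> i + l" for y
    proof -
      have "(2::nat) ^ (e - t) < 2 ^ (e - t + 1)" by simp
      then obtain x where x: "y \<le> x" "x < y + 2 ^ (e - t + 1)" "x mod 2 ^ (e - t + 1) = 2 ^ (e - t)"
        by (rule ex_mod_eq_in_window)
      then have "x + 1 < y + S" by (simp add: S_def u_def)
      then show ?thesis using agree_high_val[OF agr e True _ _ x(3)] x that by fastforce
    qed
    \<comment> \<open>The largest scale whose zone can switch off bit \<open>e\<close>.\<close>
    define K where "K = e div G"
    have G0: "0 < G" using G_bt by simp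
    have K_max: "k \<le> K" if "G * k \<le> e" for k
      using that G0 by (simp add: K_def less_eq_div_iff_mult_less_eq mult.commute)
    show ?thesis
    proof (cases "K = 0 \<or> l < S")
      case True
      have "l < S"
      proof (rule ccontr)
        assume "\<not> l < S"
        then obtain k x where "zone k x" "G * k \<le> e" using hit0[of i] by auto
        then show False using K_max[of k] True \<open>\<not> l < S\<close> by (auto simp: zone_def)
      qed
      then show ?thesis using ud by (intro exI[of _ 0] exI[of _ "2 * u"]) (auto simp: S_def)
    next
      case False
      then have K: "1 \<le> K" by simp
      have "G * K \<le> e" by (simp add: K_def)
      then have "D K dvd d" unfolding D_def using e(1) by (meson dvd_trans le_imp_power_dvd)
      then obtain q where dq: "d = q * D K" by (metis dvd_div_mult_self)
      then have q: "1 \<le> q" using d by (cases q) auto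
      have Dd: "D K \<le> d" using dq q by simp
      \<comment> \<open>From \<open>N\<close> on all zones below scale \<open>K\<close> are over,
        and discarding the positions before \<open>N\<close> costs little compared with
        \<open>d\<close>.\<close>
      define N where "N = (n + 2) * D (K - 1)"
      have N4: "N * 2 ^ (t + 2) \<le> D K" using D_pred_le[OF K] by (simp only: N_def ac_simps)
      have "N * 1 \<le> N * 2 ^ (t + 2)" by (intro mult_le_mono) auto
      then have ND: "N \<le> D K" using N4 by linarith
      have Nd: "N * 2 ^ t \<le> d" using N4 Dd by (simp add: power_add)
      have zone_K: "k = K" if "zone k x" "N \<le> x" "G * k \<le> e" for k x
      proof (rule ccontr)
        assume "k \<noteq> K"
        then have "k \<le> K - 1" using K_max[OF that(3)] by simp
        then have "(n + 2) * D k \<le> N" unfolding N_def by (intro mult_le_mono D_mono) auto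
        then show False using zone_less[OF that(1)] that(2) by linarith
      qed
      define i' where "i' = max i N"
      define j where "j = i + l"
      have l_le: "l \<le> N + (j - i')" unfolding i'_def j_def by arith
      let ?E = "(n + 1) * D K + p K"
      have hit: "\<exists>x. y \<le> x \<and> x < y + S \<and> (D K \<le> x \<and> x < ?E \<or> D K \<le> x + q * D K \<and> x + q * D K < ?E)"
        if "i' \<le> y" "y + S \<le> j" for y
      proof -
        obtain x k where x: "y \<le> x" "x + 1 < y + S" "zone k x \<or> zone k (x + d)" "G * k \<le> e"
          using hit0[of y] \<open>i' \<le> y\<close> \<open>y + S \<le> j\<close> by (auto simp: i'_def j_def)
        have "N \<le> x" using x that by (simp add: i'_def)
        then have "k = K" using zone_K[of k x] zone_K[of k "x + d"] x by auto
        then show ?thesis using x by (intro exI[of _ x]) (auto simp: zone_def dq)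
      qed
      show ?thesis
      proof (cases "j < i' + S")
        case True
        then have "l \<le> N + S" using l_le by linarith
        then show ?thesis using ud Nd
          by (intro exI[of _ 0] exI[of _ "N + 2 * u"]) (auto simp: S_def algebra_simps)
      next
        case False
        have jE: "j \<le> ?E + S"
        proof (rule ccontr)
          assume "\<not> j \<le> ?E + S"
          then have "max i' ?E + S \<le> j" using False by linarith
          then obtain x where "max i' ?E \<le> x" "x < ?E \<or> x + q * D K < ?E"
            using hit[OF max.cobounded1[of i' ?E]] by blast
          then show False by linarith
        qed
        have E2: "?E \<le> (n + 2) * D K" using p_le[OF K] by simp
        show ?thesis
        proof (cases "(n + 2) * 2 ^ t \<le> q")
          case True
          \<comment> \<open>The whole range up to the end of zone \<open>K\<close> is already short
            compared with \<open>d\<close>.\<close>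
          then have "(n + 2) * 2 ^ t * D K \<le> d" unfolding dq by (rule mult_le_mono1)
          then have "(n + 2) * D K * 2 ^ t \<le> d" by (simp only: ac_simps)
          moreover have "l \<le> N + ((n + 2) * D K + S)" using l_le jE E2 by linarith
          ultimately show ?thesis using ud Nd
            by (intro exI[of _ 0] exI[of _ "N + 2 * u + (n + 2) * D K"]) (auto simp: S_def algebra_simps)
        next
          case False
          \<comment> \<open>For smaller \<open>q\<close> both ends stay below
            \<open>D (K + 1)\<close>, so \<open>low_iff\<close> at scale \<open>K\<close> applies to
            \<open>x\<close> and to \<open>x + d\<close>.\<close>
          have "d \<le> (n + 2) * 2 ^ t * D K" unfolding dq using False by (intro mult_le_mono1) simp
          moreover have "u \<le> (n + 2) * D K"
          proof -
            have "u * 2 ^ t \<le> (n + 2) * D K * 2 ^ t" using ud calculation by (simp only: ac_simps)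
            then show ?thesis by simp
          qed
          ultimately have "j + d \<le> (n + 2) * D K * (3 + 2 ^ t) + 2"
            using jE E2 by (simp add: S_def algebra_simps)
          also have "\<dots> \<le> (n + 2) * D K * 4 * 2 ^ t"
          proof -
            have "(2::nat) ^ 1 \<le> 2 ^ t" using t1 by (intro power_increasing) auto
            then have "3 + 2 ^ t + 1 \<le> 4 * (2::nat) ^ t" by simp
            then have "(n + 2) * D K * (3 + 2 ^ t + 1) \<le> (n + 2) * D K * (4 * 2 ^ t)" by (rule mult_le_mono2)
            moreover have "2 * 1 \<le> (n + 2) * D K" using D_pos[of K] by (intro mult_le_mono) auto
            ultimately show ?thesis by (simp add: algebra_simps)
          qed
          also have "\<dots> \<le> D (K + 1)" using D_Suc_ge[of K] by (simp add: power_add algebra_simps)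
          finally have jd: "j + d \<le> D (K + 1)" .
          have "j \<le> i' + (n - 1) * (q * D K) + 2 * p K + S + 1"
          proof (rule flag_interval_bound[OF n1 q _ hit _ jE])
            show "p K < D K" using p_le[OF K] p_pos[of K] by linarith
            fix x assume x: "i' \<le> x" "x + 1 < j" "p K \<le> x mod D K"
            have "2 ^ b dvd d" using \<open>D K dvd d\<close> block_dvd_D[OF K] dvd_trans by blast
            then have "low x = low (x + d)"
              using agree_flags(1)[OF agr] x by (simp add: i'_def j_def)
            moreover have "N \<le> x" using x by (simp add: i'_def)
            ultimately show "1 \<le> x div D K \<and> x div D K \<le> n \<longleftrightarrow> x div D K + q \<le> n"
              using low_iff[OF K, of x] low_iff[OF K, of "x + d"] x jd q D_pos[of K]
              by (auto simp: N_def dq)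
          qed
          then have "l \<le> N + ((n - 1) * d + 2 * p K + S + 1)" using l_le dq by simp
          moreover have "p K * 2 ^ a \<le> d" using p_D[OF K] Dd by simp
          ultimately show ?thesis using ud Nd
            by (intro exI[of _ "p K"] exI[of _ "N + 2 * u"]) (auto simp: S_def algebra_simps)
        qed
      qed
    qed
  qed
qed

section \<open>The intended repetitions\<close>

lemma zone_unique:
  assumes "zone j x" "zone k x"
  shows "j = k"
proof -
  have False if "zone j x" "zone k x" "j < k" for j k
  proof -
    have "(n + 2) * 1 * D j \<le> (n + 2) * 2 ^ (t + 2) * D j" by (intro mult_le_mono) auto
    also have "\<dots> \<le> D (Suc j)" by (rule D_Suc_ge)
    also have "\<dots> \<le> D k" using that by (intro D_mono) simp
    finally show False using zone_less[OF that(1)] that(2) by (auto simp: zone_def)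
  qed
  then show ?thesis using assms by (metis nat_neq_iff)
qed

lemma low_iff_zone:
  assumes "zone k x"
  shows "low x \<longleftrightarrow> x div D k \<le> n \<and> p k \<le> x mod D k"
proof -
  have k: "1 \<le> k" "D k \<le> x" using assms by (auto simp: zone_def)
  have le: "(n + 2) * y \<le> (n + 2) * 2 ^ (t + 2) * y" for y :: nat
    using mult_le_mono1[OF mult_le_mono2[of 1 "2 ^ (t + 2)" "n + 2"], of y] by simp
  have "(n + 2) * D (k - 1) \<le> x" using le[of "D (k - 1)"] D_pred_le[OF k(1)] k(2) by linarith
  moreover have "x < D (k + 1)" using le[of "D k"] D_Suc_ge[of k] zone_less[OF assms] by simp
  moreover have "1 \<le> x div D k" using k D_pos[of k] by (simp add: less_eq_div_iff_mult_less_eq)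
  ultimately show ?thesis using low_iff[OF k(1)] by simp
qed

text \<open>In zone \<open>k\<close> only bits below \<open>G * k\<close> are still read, and adding
  \<open>D k\<close> does not affect them; the low stretches are spaced at distance
  \<open>D k\<close>.\<close>

lemma w_periodic:
  assumes k: "1 \<le> k" and x: "D k \<le> x" "x + D k < (n + 1) * D k + p k"
  shows "w x = w (x + D k)"
proof -
  have z: "zone k x" "zone k (x + D k)" using assms by (auto simp: zone_def)
  \<comment> \<open>Of block \<open>n + 1\<close> only the head belongs to the zone, so offsets from
    \<open>p k\<close> on are never shifted into it.\<close>
  have "x div D k + 1 \<le> n" if "p k \<le> x mod D k"
  proof (rule ccontr)
    assume "\<not> ?thesis"
    then have "n * D k \<le> x div D k * D k" by (intro mult_le_mono1) simp
    moreover have "x = x div D k * D k + x mod D k" by (simp only: div_mult_mod_eq)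
    ultimately have "n * D k + p k \<le> x" using that by linarith
    then show False using x by simp
  qed
  then have low: "low x = low (x + D k)" using low_iff_zone z D_pos[of k] by auto
  have tr: "(\<exists>k'. zone k' x \<and> G * k' \<le> f + t) \<longleftrightarrow> G * k \<le> f + t"
    "(\<exists>k'. zone k' (x + D k) \<and> G * k' \<le> f + t) \<longleftrightarrow> G * k \<le> f + t" for f
    using zone_unique z by blast+
  have dv: "2 ^ g dvd D k" if "g \<le> G * k" for g
    using that unfolding D_def by (rule le_imp_power_dvd)
  have "(x + D k) mod 2 ^ (b + t + 1) = x mod 2 ^ (b + t + 1)"
    using G_le[OF k] G_bt by (intro mod_add_dvd dv) linarith
  moreover have "(x + D k) mod 2 ^ (f + 1) = x mod 2 ^ (f + 1)" if "\<not> G * k \<le> f + t" for f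
    using that t1 by (intro mod_add_dvd dv) simp
  moreover have "odd ((x + D k) div 2 ^ (f + t)) \<longleftrightarrow> odd (x div 2 ^ (f + t))" if "\<not> G * k \<le> f + t" for f
    using that by (intro even_div_add_iff dv) simp
  ultimately have "c x = c (x + D k)" unfolding c_def tr by metis
  then show ?thesis using low by (simp add: w_def)
qed

end

section \<open>Weights of heads and tails, and bounds on the exponents\<close>

lemma card_multiples:
  fixes M u v :: nat
  assumes "0 < M" "M dvd u" "M dvd v" "u \<le> v"
  shows "card {x \<in> {u..<v}. M dvd x} * M = v - u"
proof -
  obtain u' v' where uv: "u = M * u'" "v = M * v'" using assms(2,3) by (auto elim!: dvdE)
  have "{x \<in> {u..<v}. M dvd x} = (\<lambda>y. M * y) ` {u'..<v'}"
    using assms(1) uv by (auto elim!: dvdE)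
  moreover have "inj_on (\<lambda>y. M * y) {u'..<v'}" using assms(1) by (auto intro: inj_onI)
  ultimately have "card {x \<in> {u..<v}. M dvd x} = v' - u'" by (simp add: card_image)
  then show ?thesis using uv by (simp add: diff_mult_distrib2 mult.commute)
qed

lemma sum_if_dvd:
  fixes M u v L :: nat
  shows "(\<Sum>x = u..<v. if M dvd x then L else 0) = card {x \<in> {u..<v}. M dvd x} * L"
  by (simp add: sum.If_cases Int_def)

context toeplitz_params
begin

lemma w_head:
  assumes "1 \<le> k" "D k \<le> x" "x < D k + p k"
  shows "w x \<or> 2 ^ b dvd x"
proof -
  have xd: "x div D k = 1" using assms p_le[of k] p_pos[of k] by (intro div_nat_eqI) auto
  have "x = x div D k * D k + x mod D k" by (simp only: div_mult_mod_eq)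
  then have "x mod D k < p k" using xd assms by simp
  moreover have "zone k x" using assms by (auto simp: zone_def)
  ultimately have "\<not> low x" using low_iff_zone by auto
  then show ?thesis using c_dvd by (auto simp: w_def dvd_eq_mod_eq_0)
qed

lemma w_tail:
  assumes "1 \<le> k" "D k + p k \<le> x" "x < 2 * D k"
  shows "\<not> w x \<or> 2 ^ b dvd x"
proof -
  have "low x" unfolding low_def using assms n1 by (intro exI[of _ k] exI[of _ 1]) auto
  then show ?thesis using c_dvd by (auto simp: w_def dvd_eq_mod_eq_0)
qed

lemma sum_zone:
  fixes g :: "bool \<Rightarrow> nat"
  assumes k: "1 \<le> k" and m: "m \<le> n"
  shows "(\<Sum>x = D k..<(m + 1) * D k + p k. g (w x)) =
    m * (\<Sum>x = D k..<2 * D k. g (w x)) + (\<Sum>x = D k..<D k + p k. g (w x))"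
  using m
proof (induction m)
  case (Suc m)
  have "(\<Sum>x = D k..<(Suc m + 1) * D k + p k. g (w x)) =
    (\<Sum>x = D k..<2 * D k. g (w x)) + (\<Sum>x = 2 * D k..<(Suc m + 1) * D k + p k. g (w x))"
    by (intro sum.atLeastLessThan_concat[symmetric]) auto
  also have "(\<Sum>x = 2 * D k..<(Suc m + 1) * D k + p k. g (w x)) =
    (\<Sum>x = D k..<(m + 1) * D k + p k. g (w (x + D k)))"
    using sum.shift_bounds_nat_ivl[of "\<lambda>x. g (w x)" "D k" "D k" "(m + 1) * D k + p k"]
    by (simp add: algebra_simps mult_2 mult_2_right)
  also have "\<dots> = (\<Sum>x = D k..<(m + 1) * D k + p k. g (w x))"
  proof (intro sum.cong refl)
    fix x assume x: "x \<in> {D k..<(m + 1) * D k + p k}"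
    have "(m + 1) * D k \<le> n * D k" using Suc.prems by (intro mult_le_mono1) simp
    then show "g (w (x + D k)) = g (w x)" using w_periodic[OF k, of x] x by simp
  qed
  finally show ?case using Suc by simp
qed simp

lemma ACE_w_ge: "ereal (real n + 1 / 2 ^ a) \<le> ACE w"
proof (rule ACE_ge)
  fix N
  let ?k = "Suc N"
  have "D ?k = p ?k * 2 ^ a" using p_D[of ?k] by simp
  then have "1 / 2 ^ a * real (D ?k) = real (p ?k)" by simp
  then have "(real n + 1 / 2 ^ a) * real (D ?k) \<le> real (n * D ?k + p ?k)"
    by (simp only: distrib_right) simp
  moreover have "D ?k \<le> n * D ?k" using n1 by simp
  moreover have "N \<le> D ?k" using D_ge[of ?k] by simp
  moreover have "w (D ?k + j + D ?k) = w (D ?k + j)" if "j + D ?k < n * D ?k + p ?k" for j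
    using w_periodic[of ?k "D ?k + j"] that by simp
  ultimately show "\<exists>s d m. N \<le> m \<and> 0 < d \<and> d \<le> m \<and> (real n + 1 / 2 ^ a) * real d \<le> real m \<and>
      (\<forall>j. j + d < m \<longrightarrow> w (s + j + d) = w (s + j))"
    using D_pos[of ?k]
    by (intro exI[of _ "D ?k"] exI[of _ "n * D ?k + p ?k"] conjI allI impI) (assumption | linarith | blast)+
qed

lemma ACE_w_le:
  assumes lam: "0 < lam" "8 / lam \<le> 2 ^ a" "16 / lam \<le> 2 ^ t"
  shows "ACE w \<le> ereal (real n + lam)"
proof -
  let ?C = "real (3 * 2 ^ (b + t + 1) + 3)"
  \<comment> \<open>Half of \<open>lam\<close> pays for \<open>2 * u + v\<close>; the other half is
    the \<open>\<epsilon>\<close> of \<open>ACE_le\<close> and absorbs the constant.\<close>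
  have "ACE w \<le> ereal (real n + lam / 2 + lam / 2)"
  proof (rule ACE_le)
    show "1 \<le> real n + lam / 2" "0 < lam / 2" "0 \<le> ?C" using n1 lam by auto
    fix i d l :: nat
    assume d: "0 < d" and "\<And>x. i \<le> x \<Longrightarrow> x < i + l \<Longrightarrow> w x = w (x + d)"
    then obtain u v where *: "l \<le> (n - 1) * d + 2 * u + v + (3 * 2 ^ (b + t + 1) + 3)"
      "u * 2 ^ a \<le> d" "v * 2 ^ t \<le> 4 * d"
      using agree_bound[of i l d] by blast
    have "8 \<le> lam * 2 ^ a" "16 \<le> lam * 2 ^ t" using lam by (simp_all add: field_simps)
    then have "real u * 8 \<le> real u * (lam * 2 ^ a)" "real v * 16 \<le> real v * (lam * 2 ^ t)"
      by (simp_all add: mult_left_mono)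
    moreover have "lam * real (u * 2 ^ a) \<le> lam * real d" "lam * real (v * 2 ^ t) \<le> lam * real (4 * d)"
      using *(2,3) lam(1) by (intro mult_left_mono of_nat_mono; simp)+
    ultimately have uv: "8 * real u \<le> lam * d" "16 * real v \<le> 4 * lam * d"
      by (simp_all add: algebra_simps)
    have "real l \<le> real ((n - 1) * d + 2 * u + v + (3 * 2 ^ (b + t + 1) + 3))"
      using *(1) by (simp only: of_nat_le_iff)
    also have "\<dots> = (real n - 1) * d + 2 * real u + real v + ?C"
      using n1 by (simp add: of_nat_diff)
    finally show "real l \<le> (real n + lam / 2 - 1) * real d + ?C"
      using uv by (simp add: algebra_simps)
  qed
  then show ?thesis by (simp add: ac_simps)
qed

text \<open>If the head and the rest of a period have image lengths \<open>?A\<close> and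
  \<open>?Z\<close>, the image of a zone has exponent \<open>n + ?A / (?A + ?Z)\<close>, so
  \<open>?Z \<le> \<delta> * ?A\<close> suffices. Large \<open>L\<close> makes the head heavy, and
  large \<open>b\<close> keeps the deviations in the rest rare.\<close>

lemma ACE_image_ge:
  assumes \<delta>: "0 < \<delta>" "\<delta> < 1" and L: "4 * 2 ^ a / \<delta> \<le> real L" and b: "4 * 2 ^ a / \<delta> \<le> 2 ^ b"
  shows "ereal (real n + 1 - \<delta>) \<le> ACE (morph_inf (\<lambda>y. if y then replicate L \<beta> else [\<alpha>]) w)"
    (is "_ \<le> ACE (morph_inf ?f w)")
proof -
  have "0 < 4 * 2 ^ a / \<delta>" using \<delta> by simp
  then have L0: "0 < L" using L by linarith
  define g where "g = (\<lambda>y. if y then L else 1)"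
  have len: "length (?f y) = g y" for y by (simp add: g_def)
  show ?thesis
  proof (rule ACE_morph_inf_ge)
    show "?f y \<noteq> []" for y using L0 by simp
    fix N
    define k where "k = Suc N"
    have k: "1 \<le> k" by (simp add: k_def)
    let ?A = "\<Sum>x = D k..<D k + p k. g (w x)"
    let ?Z = "\<Sum>x = D k + p k..<2 * D k. g (w x)"
    \<comment> \<open>The agreement is one period shorter than the zone.\<close>
    let ?l = "(n - 1) * D k + p k"
    have AZ: "(\<Sum>x = D k..<2 * D k. g (w x)) = ?A + ?Z"
      using p_le[OF k] by (intro sum.atLeastLessThan_concat[symmetric]) auto
    have dv: "2 ^ b dvd D k" "2 ^ b dvd p k" using block_dvd_D[OF k] block_dvd_p[OF k] by auto
    \<comment> \<open>At most a quarter of the head consists of block starts, as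
      \<open>2 ^ b \<ge> 4\<close>; all other positions there weigh \<open>L\<close>.\<close>
    have A: "L * p k \<le> 2 * ?A"
    proof -
      let ?c = "card {x \<in> {D k..<D k + p k}. 2 ^ b dvd x}"
      have "?c * 2 ^ b = p k" using card_multiples[of "2 ^ b" "D k" "D k + p k"] dv by simp
      moreover have "?c * 4 \<le> ?c * 2 ^ b" using block_ge_4 by (intro mult_le_mono2)
      ultimately have "L * (?c * 4) \<le> L * p k" by (intro mult_le_mono2) simp
      moreover have "L * p k = (\<Sum>x = D k..<D k + p k. L)" by simp
      moreover have "(\<Sum>x = D k..<D k + p k. L) \<le>
          (\<Sum>x = D k..<D k + p k. g (w x) + (if 2 ^ b dvd x then L else 0))"
        using w_head[OF k] by (intro sum_mono) (auto simp: g_def)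
      ultimately have "L * p k \<le> ?A + ?c * L" by (simp only: sum.distrib sum_if_dvd)
      moreover have "L * (?c * 4) = 4 * (?c * L)" by simp
      ultimately show ?thesis using \<open>L * (?c * 4) \<le> L * p k\<close> by linarith
    qed
    have Z: "2 ^ b * ?Z \<le> 2 ^ b * D k + L * D k"
    proof -
      let ?c = "card {x \<in> {D k + p k..<2 * D k}. 2 ^ b dvd x}"
      have "?c * 2 ^ b = 2 * D k - (D k + p k)"
        using card_multiples[of "2 ^ b" "D k + p k" "2 * D k"] dv p_le[OF k] by simp
      then have "L * (?c * 2 ^ b) \<le> L * D k" by (intro mult_le_mono2) simp
      moreover have "?Z \<le> (\<Sum>x = D k + p k..<2 * D k. 1 + (if 2 ^ b dvd x then L else 0))"
        using w_tail[OF k] by (intro sum_mono) (auto simp: g_def)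
      then have "?Z \<le> D k + ?c * L" by (simp only: sum.distrib sum_if_dvd) simp
      then have "2 ^ b * ?Z \<le> 2 ^ b * (D k + ?c * L)" by (intro mult_le_mono2)
      moreover have "2 ^ b * (D k + ?c * L) = 2 ^ b * D k + L * (?c * 2 ^ b)"
        by (simp only: distrib_left ac_simps)
      ultimately show ?thesis by linarith
    qed
    \<comment> \<open>By hypothesis \<open>2 ^ a\<close> is at most \<open>\<delta> * L / 4\<close>
      and at most \<open>\<delta> * 2 ^ b / 4\<close>. With \<open>D k = 2 ^ a * p k\<close>, each
      of the two terms of \<open>Z\<close> contributes at most \<open>\<delta> * L * p k / 4\<close>
      to \<open>?Z\<close>.\<close>
    have ZA: "real ?Z \<le> \<delta> * real ?A"
    proof -
      have "2 ^ b * real ?Z \<le> 2 ^ b * real (D k) + real L * real (D k)"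
        using Z[THEN of_nat_mono[where 'a = real]] by simp
      also have "\<dots> = (2 ^ b * 2 ^ a + real L * 2 ^ a) * real (p k)"
        using p_D[OF k, symmetric] by (simp add: algebra_simps)
      also have "\<dots> \<le> (2 ^ b * (\<delta> * L / 4) + real L * (\<delta> * 2 ^ b / 4)) * real (p k)"
        using L b \<delta> by (intro mult_right_mono add_mono mult_left_mono) (auto simp: field_simps)
      also have "\<dots> = 2 ^ b * (\<delta> / 2) * real (L * p k)" by (simp add: algebra_simps)
      also have "\<dots> \<le> 2 ^ b * (\<delta> / 2) * real (2 * ?A)"
        using A \<delta> by (intro mult_left_mono) (simp_all only: of_nat_le_iff, simp)
      finally show ?thesis by simp
    qed
    have "(real n + 1 - \<delta>) * real (?A + ?Z) = real n * real (?A + ?Z) + (1 - \<delta>) * real (?A + ?Z)"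
      by (simp only: distrib_right[symmetric]) simp
    also have "(1 - \<delta>) * real (?A + ?Z) \<le> real ?A"
    proof -
      have "0 \<le> \<delta> * real ?Z" using \<delta> by (intro mult_nonneg_nonneg) (auto simp del: of_nat_sum)
      then show ?thesis using ZA unfolding of_nat_add by (simp only: algebra_simps)
    qed
    finally have "(real n + 1 - \<delta>) * real (?A + ?Z) \<le> real (n * (?A + ?Z) + ?A)" by simp
    then have "(real n + 1 - \<delta>) * real (\<Sum>x = D k..<2 * D k. g (w x)) \<le>
        real (\<Sum>x = D k..<(n + 1) * D k + p k. g (w x))"
      using sum_zone[OF k order_refl, of g] AZ by simp
    moreover have eq: "D k + D k + ?l = (n + 1) * D k + p k"
    proof -
      obtain n' where "n = Suc n'" using n1 by (cases n) auto
      then show ?thesis by simp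
    qed
    moreover have "\<forall>x. D k \<le> x \<longrightarrow> x < D k + ?l \<longrightarrow> w x = w (x + D k)"
    proof (intro allI impI)
      fix x assume "D k \<le> x" "x < D k + ?l"
      then show "w x = w (x + D k)" using eq by (intro w_periodic[OF k]) linarith+
    qed
    moreover have "N \<le> ?l"
    proof -
      have "N \<le> b * k" using b2 mult_le_mono1[of 1 b k] by (simp add: k_def)
      also have "\<dots> \<le> G * k - a"
      proof -
        have "(a + b) * k \<le> G * k" using G_ab by (rule mult_le_mono1)
        moreover have "a \<le> a * k" using k by simp
        ultimately have "b * k + a \<le> G * k" unfolding add_mult_distrib by linarith
        then show ?thesis by simp
      qed
      also have "\<dots> < p k" unfolding p_def by (rule less_exp)
      also have "\<dots> \<le> ?l" by simp
      finally show ?thesis by simp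
    qed
    ultimately show "\<exists>s d l. N \<le> l \<and> 0 < d \<and>
      (\<forall>x. s \<le> x \<longrightarrow> x < s + l \<longrightarrow> w x = w (x + d)) \<and>
      (real n + 1 - \<delta>) * real (\<Sum>x = s..<s + d. length (?f (w x)))
        \<le> real (\<Sum>x = s..<s + d + l. length (?f (w x)))"
      unfolding len using D_pos[of k]
      by (intro exI[of _ "D k"] exI[of _ ?l] conjI) (simp_all only: mult_2)
  qed
qed

end

section \<open>Choice of the parameters\<close>

theorem theorem33:
  fixes n :: nat and lam \<delta> :: real
  assumes "n \<ge> 1" and "0 < lam" and "lam < 1" and "\<delta> > 0"
  shows "\<exists>w :: nat \<Rightarrow> bool.
           ereal (real n) < ACE w \<and> ACE w \<le> ereal (real n + lam) \<and>
           (\<forall>\<Gamma> :: nat set. finite \<Gamma> \<and> card \<Gamma> \<ge> 2 \<longrightarrow>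
              ACE_I \<Gamma> w \<ge> ereal (real n + 1 - \<delta>))"
proof -
  have pow: "\<exists>k. y \<le> (2::real) ^ k" for y
    using real_arch_pow[of 2 y] by (auto intro: less_imp_le)
  \<comment> \<open>\<open>ACE_image_ge\<close> requires a value below 1, and decreasing
    \<open>\<delta>\<close> only strengthens the bound.\<close>
  define \<delta>' where "\<delta>' = min \<delta> (1 / 2)"
  have \<delta>': "0 < \<delta>'" "\<delta>' < 1" "\<delta>' \<le> \<delta>" using assms by (auto simp: \<delta>'_def)
  \<comment> \<open>\<open>a\<close> and \<open>t\<close> depend on \<open>lam\<close> only,
    \<open>b\<close> and \<open>L\<close> also on \<open>a\<close>, and \<open>G\<close> is chosen
    last.\<close>
  obtain a where a: "8 / lam \<le> 2 ^ a" using pow by blast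
  obtain t where t: "16 / lam \<le> 2 ^ t" using pow by blast
  obtain b where b: "4 * 2 ^ a / \<delta>' \<le> 2 ^ b" using pow by blast
  obtain L :: nat where L: "4 * 2 ^ a / \<delta>' \<le> real L" using real_arch_simple by blast
  have one: "1 \<le> a" "1 \<le> t"
  proof -
    have "8 < 8 / lam" "16 < 16 / lam" using assms by (simp_all add: field_simps)
    then have "(2::real) ^ 0 < 2 ^ a" "(2::real) ^ 0 < 2 ^ t" using a t by simp_all
    then show "1 \<le> a" "1 \<le> t" by (simp_all only: power_strict_increasing_iff)
  qed
  have "2 \<le> b"
  proof -
    have "1 * 1 \<le> (2 ^ a) * (1 / \<delta>')" using \<delta>' by (intro mult_mono) auto
    then have "(2::real) ^ 2 \<le> 2 ^ b" using b by simp
    then show ?thesis by (simp only: power_increasing_iff)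
  qed
  obtain g where g: "real ((n + 2) * 2 ^ (t + 2)) \<le> 2 ^ g" using pow by blast
  define G where "G = a + b + t + 2 + g"
  have "(2::real) ^ g \<le> 2 ^ G" by (intro power_increasing) (auto simp: G_def)
  then have "real ((n + 2) * 2 ^ (t + 2)) \<le> real (2 ^ G)"
    using g unfolding of_nat_power of_nat_numeral by linarith
  then have "(n + 2) * 2 ^ (t + 2) \<le> 2 ^ G" by (simp only: of_nat_le_iff)
  moreover have "a + b \<le> G" "b + t + 2 \<le> G" by (simp_all add: G_def)
  ultimately interpret toeplitz_params n a t b G
    using assms(1) one \<open>2 \<le> b\<close> by (intro toeplitz_params.intro)
  have "ereal (real n + 1 - \<delta>) \<le> ACE_I \<Gamma> w" if "finite \<Gamma> \<and> 2 \<le> card \<Gamma>" for \<Gamma> :: "nat set"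
  proof -
    have "finite \<Gamma>" "\<not> card \<Gamma> \<le> Suc 0" using that by simp_all
    then obtain \<alpha> \<beta> where ab: "\<alpha> \<in> \<Gamma>" "\<beta> \<in> \<Gamma>" "\<alpha> \<noteq> \<beta>"
      using card_le_Suc0_iff_eq[of \<Gamma>] by blast
    let ?f = "\<lambda>y. if y then replicate L \<beta> else [\<alpha>]"
    have "0 < 4 * 2 ^ a / \<delta>'" using \<delta>' by simp
    then have "0 < L" using L by linarith
    then have f: "?f \<in> {f. inj (morph f) \<and> (\<forall>y. set (f y) \<subseteq> \<Gamma>)}"
      using inj_morph_replicate[of \<alpha> \<beta> L] ab by auto
    have "ereal (real n + 1 - \<delta>) \<le> ereal (real n + 1 - \<delta>')" using \<delta>' by simp
    also have "\<dots> \<le> ACE (morph_inf ?f w)" using \<delta>' L b by (intro ACE_image_ge)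
    also have "\<dots> \<le> ACE_I \<Gamma> w" unfolding ACE_I_def using f by (rule SUP_upper)
    finally show ?thesis .
  qed
  moreover have "ereal (real n) < ACE w"
    using ACE_w_ge by (rule less_le_trans[rotated]) simp
  moreover have "ACE w \<le> ereal (real n + lam)" using assms(2) a t by (rule ACE_w_le)
  ultimately show ?thesis by blast
qed

end
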